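(* Let $1\le k\le n$, let $P$ be a $k$-element poset, and let $\mathcal F:=\mathcal F_{2^{n-1}}$ be the output of the (non-induced) greedy colex process for $P$ on ground set $[n]$. Then $\mathcal F$ is non-induced $P$-saturating, $\mathcal F=\mathcal F_{2^{k-3}}$, and therefore $|\mathcal F|\le 2^{k-2}$. In particular, $\mathrm{sat}(n,P)\le 2^{k-2}$.
   Context: $2^{[n]}$ is the family of all subsets of $[n]$ ordered by inclusion. A subfamily $\mathcal G\subseteq\mathcal F\subseteq 2^{[n]}$ is a non-induced copy of a poset $P$ if there is a bijection $i:P\to\mathcal G$ such that $p\le_P q$ implies $i(p)\subseteq i(q)$; $\mathcal F$ is $P$-free if it contains no non-induced copy of $P$, and non-induced $P$-saturating if it is $P$-free and adding any $G\in 2^{[n]}\setminus \mathcal F$ creates a non-induced copy of $P$. $\mathrm{sat}(n,P)$ is the minimum size of such a saturating family. The colex order on finite subsets of positive integers: $A<B$ iff $\max(A\triangle B)\in B$. Let $F_1,F_2,\dots,F_{2^{n-1}}$ enumerate $2^{[n-1]}$ in colex order and let $G_i=[n]\setminus F_i$. The greedy colex process: set $\mathcal F_0=\emptyset$; for $i=0,1,\dots,2^{n-1}-1$, let $\mathcal F_i'=\mathcal F_i\cup\{F_{i+1}\}$ if this family is $P$-free and $\mathcal F_i'=\mathcal F_i$ otherwise; then let $\mathcal F_{i+1}=\mathcal F_i'\cup\{G_{i+1}\}$ if this family is $P$-free and $\mathcal F_{i+1}=\mathcal F_i'$ otherwise. The output is $\mathcal F_{2^{n-1}}$.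
   Formalization: For k = 1 and k = 2 the index 2^{k-3} is fractional, so the family F_{2^{k-3}} is undefined; the index is read as the ceiling of 2^{k-3}, that is F_1 in these two cases, with no change for k ≥ 3. *)

theory Defs
  imports Complex_Main
begin

text \<open>A poset is given by a carrier \<open>A\<close> and a relation \<open>r\<close> with \<open>partial_order_on A r\<close>;
  the ground set \<open>[n]\<close> is \<open>{1..n}\<close>.\<close>

definition noninduced_copy :: "'a set \<Rightarrow> 'a rel \<Rightarrow> nat set set \<Rightarrow> bool" where
  "noninduced_copy A r \<G> \<longleftrightarrow>
     (\<exists>i. bij_betw i A \<G> \<and> (\<forall>p\<in>A. \<forall>q\<in>A. (p, q) \<in> r \<longrightarrow> i p \<subseteq> i q))"

definition poset_free :: "'a set \<Rightarrow> 'a rel \<Rightarrow> nat set set \<Rightarrow> bool" where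
  "poset_free A r \<F> \<longleftrightarrow> (\<nexists>\<G>. \<G> \<subseteq> \<F> \<and> noninduced_copy A r \<G>)"

definition noninduced_saturating :: "nat \<Rightarrow> 'a set \<Rightarrow> 'a rel \<Rightarrow> nat set set \<Rightarrow> bool" where
  "noninduced_saturating n A r \<F> \<longleftrightarrow>
     \<F> \<subseteq> Pow {1..n} \<and> poset_free A r \<F> \<and>
     (\<forall>G \<in> Pow {1..n} - \<F>. \<not> poset_free A r (insert G \<F>))"

definition sat :: "nat \<Rightarrow> 'a set \<Rightarrow> 'a rel \<Rightarrow> nat" where
  "sat n A r = Min (card ` {\<F>. noninduced_saturating n A r \<F>})"

text \<open>The condition \<open>X \<noteq> Y\<close> is needed because \<open>Max {}\<close> is unspecified; on infinite sets the
  relation is meaningless.\<close>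

definition colex_less :: "nat set \<Rightarrow> nat set \<Rightarrow> bool" where
  "colex_less X Y \<longleftrightarrow> X \<noteq> Y \<and> Max ((X - Y) \<union> (Y - X)) \<in> Y"

definition colex_list :: "nat \<Rightarrow> nat set list" where
  "colex_list m = (THE Fs. set Fs = Pow {1..m} \<and> sorted_wrt colex_less Fs)"

text \<open>The indices \<open>i\<close> of \<open>F\<^sub>i\<close> and \<open>G\<^sub>i\<close> start at \<open>1\<close>, list positions at \<open>0\<close>.\<close>

definition colex_F :: "nat \<Rightarrow> nat \<Rightarrow> nat set" where
  "colex_F n i = colex_list (n - 1) ! (i - 1)"

definition colex_G :: "nat \<Rightarrow> nat \<Rightarrow> nat set" where
  "colex_G n i = {1..n} - colex_F n i"

definition add_if_free :: "'a set \<Rightarrow> 'a rel \<Rightarrow> nat set \<Rightarrow> nat set set \<Rightarrow> nat set set" where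
  "add_if_free A r X \<F> = (if poset_free A r (insert X \<F>) then insert X \<F> else \<F>)"

text \<open>The value at \<open>i\<close> is the intended family only for \<open>i \<le> 2 ^ (n - 1)\<close>.\<close>

primrec greedy_colex :: "nat \<Rightarrow> 'a set \<Rightarrow> 'a rel \<Rightarrow> nat \<Rightarrow> nat set set" where
  "greedy_colex n A r 0 = {}"
| "greedy_colex n A r (Suc i) =
     add_if_free A r (colex_G n (i + 1)) (add_if_free A r (colex_F n (i + 1)) (greedy_colex n A r i))"

definition greedy_output :: "nat \<Rightarrow> 'a set \<Rightarrow> 'a rel \<Rightarrow> nat set set" where
  "greedy_output n A r = greedy_colex n A r (2 ^ (n - 1))"

text \<open>The list defined by \<open>colex_list\<close> exists and is unique.\<close>

lemma colex_less_insert: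
  assumes "X \<subseteq> {1..m}" "Y \<subseteq> {1..m}" "colex_less X Y"
  shows "colex_less (insert (Suc m) X) (insert (Suc m) Y)"
proof -
  have n: "Suc m \<notin> X" "Suc m \<notin> Y" using assms by auto
  then have "(insert (Suc m) X - insert (Suc m) Y) \<union> (insert (Suc m) Y - insert (Suc m) X)
      = (X - Y) \<union> (Y - X)" by auto
  moreover have "insert (Suc m) X \<noteq> insert (Suc m) Y"
    using assms(3) n unfolding colex_less_def by (metis insert_ident)
  ultimately show ?thesis using assms(3) by (simp add: colex_less_def)
qed

lemma colex_less_new:
  assumes "X \<subseteq> {1..m}" "Y \<subseteq> {1..m}"
  shows "colex_less X (insert (Suc m) Y)"
proof -
  let ?D = "(X - insert (Suc m) Y) \<union> (insert (Suc m) Y - X)"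
  have "Suc m \<notin> X" using assms by auto
  moreover have "finite ?D" using assms finite_subset[of _ "{1..m}"] by auto
  moreover have "\<forall>z\<in>?D. z \<le> Suc m" using assms by fastforce
  ultimately have "Max ?D = Suc m" by (intro Max_eqI) auto
  then show ?thesis using \<open>Suc m \<notin> X\<close> by (auto simp: colex_less_def)
qed

lemma colex_less_asym:
  "colex_less X Y \<Longrightarrow> finite X \<Longrightarrow> finite Y \<Longrightarrow> \<not> colex_less Y X"
proof
  assume a: "colex_less X Y" "finite X" "finite Y" "colex_less Y X"
  let ?D = "(X - Y) \<union> (Y - X)"
  have "?D \<noteq> {}" using a(1) by (auto simp: colex_less_def)
  then have "Max ?D \<in> ?D" using a by (intro Max_in) auto
  moreover have "(Y - X) \<union> (X - Y) = ?D" by auto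
  ultimately show False using a(1,4) by (auto simp: colex_less_def)
qed

lemma colex_list_exists: "\<exists>Fs. set Fs = Pow {1..m} \<and> sorted_wrt colex_less Fs"
proof (induction m)
  case 0
  show ?case by (rule exI[of _ "[{}]"]) simp
next
  case (Suc m)
  then obtain Fs where Fs: "set Fs = Pow {1..m}" "sorted_wrt colex_less Fs" by blast
  let ?Gs = "Fs @ map (insert (Suc m)) Fs"
  have "sorted_wrt (\<lambda>X Y. colex_less (insert (Suc m) X) (insert (Suc m) Y)) Fs"
    by (rule sorted_wrt_mono_rel[OF _ Fs(2)]) (use Fs(1) colex_less_insert in auto)
  then have "sorted_wrt colex_less ?Gs"
    using Fs colex_less_new by (auto simp: sorted_wrt_append sorted_wrt_map)
  moreover have "set ?Gs = Pow {1..Suc m}"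
    using Fs(1) by (simp add: atLeastAtMostSuc_conv Pow_insert)
  ultimately show ?case by blast
qed

lemma sorted_wrt_asym_unique:
  assumes "\<And>x y. x \<in> S \<Longrightarrow> y \<in> S \<Longrightarrow> R x y \<Longrightarrow> \<not> R y x"
    and "set xs = set ys" "set xs \<subseteq> S" "sorted_wrt R xs" "sorted_wrt R ys"
  shows "xs = ys"
  using assms(2-)
proof (induction xs arbitrary: ys)
  case Nil
  then show ?case by simp
next
  case (Cons x xs)
  then obtain y ys' where ys: "ys = y # ys'" by (cases ys) auto
  have "x = y"
  proof (rule ccontr)
    assume "x \<noteq> y"
    then have "R x y" "R y x" "x \<in> S" "y \<in> S" using Cons.prems ys by auto
    then show False using assms(1) by blast
  qed
  moreover have "x \<notin> set xs" "y \<notin> set ys'"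
    using Cons.prems ys assms(1) by (metis list.set_intros(1) sorted_wrt.simps(2) subset_iff)+
  ultimately show ?case using Cons ys by (metis insert_ident list.simps(15) set_subset_Cons
      order_trans sorted_wrt.simps(2))
qed

lemma
  shows set_colex_list: "set (colex_list m) = Pow {1..m}"
    and sorted_colex_list: "sorted_wrt colex_less (colex_list m)"
proof -
  have "\<exists>!Fs. set Fs = Pow {1..m} \<and> sorted_wrt colex_less Fs"
  proof (rule ex_ex1I[OF colex_list_exists])
    fix xs ys
    assume a: "set xs = Pow {1..m} \<and> sorted_wrt colex_less xs"
      "set ys = Pow {1..m} \<and> sorted_wrt colex_less ys"
    show "xs = ys"
      by (rule sorted_wrt_asym_unique[of "Pow {1..m}" colex_less])
        (use a colex_less_asym finite_subset[of _ "{1..m}"] in auto)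
  qed
  from theI'[OF this] show "set (colex_list m) = Pow {1..m}" "sorted_wrt colex_less (colex_list m)"
    unfolding colex_list_def by auto
qed

end

theory Submission
  imports Defs
begin

text \<open>
  Let \<open>m = k - 3\<close> and let \<open>X \<subseteq> [n]\<close> be neither a subset of \<open>[m]\<close> nor the complement of one.
  Suppose \<open>X\<close> could be added to \<open>\<F>\<close>, the family after \<open>2 ^ m\<close> steps. For each \<open>j \<le> m\<close> the set
  \<open>X \<inter> [j]\<close> was then accepted: a copy of \<open>P\<close> that caused its rejection would remain a copy with
  \<open>X \<inter> [j]\<close> replaced by \<open>X\<close>, because all sets considered before it are subsets of \<open>[j]\<close> that do not
  contain it, or complements of such sets. Dually \<open>[n] - ([j] - X)\<close> was accepted. These sets form
  together with \<open>X\<close> a chain of \<open>m + 3 \<ge> k\<close> sets, which contains a copy of every \<open>k\<close>-element poset,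
  a contradiction. Hence \<open>\<F>\<close> is already saturating.
\<close>

section \<open>Copies of a poset\<close>

lemma not_poset_free_iff:
  "\<not> poset_free A r \<F> \<longleftrightarrow>
     (\<exists>i. inj_on i A \<and> i ` A \<subseteq> \<F> \<and> (\<forall>p\<in>A. \<forall>q\<in>A. (p, q) \<in> r \<longrightarrow> i p \<subseteq> i q))"
  unfolding poset_free_def noninduced_copy_def bij_betw_def by auto

lemma poset_free_subset: "poset_free A r \<F> \<Longrightarrow> \<G> \<subseteq> \<F> \<Longrightarrow> poset_free A r \<G>"
  unfolding poset_free_def by blast

lemma poset_free_empty: "A \<noteq> {} \<Longrightarrow> poset_free A r {}"
  using not_poset_free_iff[of A r "{}"] by auto

text \<open>Exchange argument: in a copy that uses \<open>Y\<close>, the element placed at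
  \<open>Y\<close> moves to \<open>X\<close>. The last two premises let comparabilities with
  \<open>Y\<close> survive, and \<open>X \<notin> \<H>\<close> keeps the map injective.\<close>

lemma not_poset_free_replace:
  assumes "\<not> poset_free A r (insert Y \<H>)" and "X \<notin> \<H>"
    and below: "\<And>Z. Z \<in> \<H> \<Longrightarrow> Z \<subseteq> Y \<Longrightarrow> Z \<subseteq> X"
    and above: "\<And>Z. Z \<in> \<H> \<Longrightarrow> Z \<noteq> Y \<Longrightarrow> Y \<subseteq> Z \<Longrightarrow> X \<subseteq> Z"
  shows "\<not> poset_free A r (insert X \<H>)"
proof -
  obtain i where i: "inj_on i A" "i ` A \<subseteq> insert Y \<H>"
      "\<forall>p\<in>A. \<forall>q\<in>A. (p, q) \<in> r \<longrightarrow> i p \<subseteq> i q"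
    using assms(1) unfolding not_poset_free_iff by (elim exE conjE)
  define i' where "i' p = (if i p = Y then X else i p)" for p
  have mem: "i p \<in> \<H>" if "p \<in> A" "i p \<noteq> Y" for p
    using i(2) that by auto
  have "inj_on i' A"
  proof (rule inj_onI)
    fix p q assume "p \<in> A" "q \<in> A" "i' p = i' q"
    then have "i p = i q"
      using mem[of p] mem[of q] \<open>X \<notin> \<H>\<close> by (auto simp: i'_def split: if_splits)
    then show "p = q" using i(1) \<open>p \<in> A\<close> \<open>q \<in> A\<close> by (auto dest: inj_onD)
  qed
  moreover have "i' ` A \<subseteq> insert X \<H>"
    using mem by (simp add: i'_def image_subset_iff)
  moreover have "i' p \<subseteq> i' q" if "p \<in> A" "q \<in> A" "(p, q) \<in> r" for p q
  proof -
    have "i p \<subseteq> i q" using i(3) that by simp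
    then show ?thesis
      using below[OF mem, OF that(1)] above[OF mem, OF that(2)] by (simp add: i'_def)
  qed
  ultimately show ?thesis unfolding not_poset_free_iff by (intro exI[of _ i']) simp
qed

text \<open>Sending a maximal element \<open>p\<close> to the greatest member \<open>M\<close> and
  recursing builds a linear extension from the top. Antisymmetry and transitivity do not mention the
  carrier, so \<open>r\<close> stays fixed while \<open>A\<close> shrinks.\<close>

lemma chain_noninduced_copy:
  assumes "finite A" "antisym r" "trans r" "finite \<C>" "card \<C> = card A"
    and "\<And>X Y. X \<in> \<C> \<Longrightarrow> Y \<in> \<C> \<Longrightarrow> X \<subseteq> Y \<or> Y \<subseteq> X"
  shows "noninduced_copy A r \<C>"
  using assms
proof (induction "card A" arbitrary: A \<C>)
  case 0
  then show ?case by (auto simp: noninduced_copy_def bij_betw_def)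
next
  case (Suc c)
  have ne: "A \<noteq> {}" "\<C> \<noteq> {}" using Suc.hyps(2) Suc.prems(5) by auto
  obtain p where p: "p \<in> A" "\<And>q. q \<in> A \<Longrightarrow> (p, q) \<in> r \<Longrightarrow> q = p"
  proof -
    have "\<exists>m\<in>A. \<forall>x\<in>A. x \<noteq> m \<longrightarrow> \<not> ((m, x) \<in> r \<and> m \<noteq> x)"
    proof (rule Finite_Set.bex_max_element[OF \<open>finite A\<close> _ _ \<open>A \<noteq> {}\<close>])
      show "asymp_on A (\<lambda>x y. (x, y) \<in> r \<and> x \<noteq> y)"
        using \<open>antisym r\<close> by (auto intro!: asymp_onI dest: antisymD)
      show "transp_on A (\<lambda>x y. (x, y) \<in> r \<and> x \<noteq> y)"
        using \<open>antisym r\<close> \<open>trans r\<close> by (auto intro!: transp_onI dest: antisymD transD)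
    qed
    then show thesis using that by blast
  qed
  obtain M where M: "M \<in> \<C>" "\<And>X. X \<in> \<C> \<Longrightarrow> X \<subseteq> M"
    using finite_has_maximal[OF \<open>finite \<C>\<close> \<open>\<C> \<noteq> {}\<close>] Suc.prems(6) by metis
  have "noninduced_copy (A - {p}) r (\<C> - {M})"
    by (rule Suc.hyps(1)) (use Suc.prems Suc.hyps(2) p(1) M(1) in auto)
  then obtain i where i: "bij_betw i (A - {p}) (\<C> - {M})"
      "\<And>q s. q \<in> A - {p} \<Longrightarrow> s \<in> A - {p} \<Longrightarrow> (q, s) \<in> r \<Longrightarrow> i q \<subseteq> i s"
    unfolding noninduced_copy_def by blast
  let ?i = "i(p := M)"
  have "bij_betw ?i (A - {p}) (\<C> - {M})"
    using i(1) by (subst bij_betw_cong[of _ _ i]) auto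
  then have "bij_betw ?i (insert p (A - {p})) (insert M (\<C> - {M}))"
    using notIn_Un_bij_betw[of p "A - {p}" ?i "\<C> - {M}"] by simp
  then have bij: "bij_betw ?i A \<C>"
    using p(1) M(1) by (simp add: insert_absorb)
  moreover have "?i q \<subseteq> ?i s" if qs: "q \<in> A" "s \<in> A" "(q, s) \<in> r" for q s
  proof (cases "s = p")
    case True
    have "?i q \<in> \<C>" using bij qs(1) by (rule bij_betw_apply)
    then show ?thesis using True M(2) by auto
  next
    case False
    then show ?thesis using p(2) i(2) qs by auto
  qed
  ultimately show ?case unfolding noninduced_copy_def by blast
qed

lemma not_poset_free_chain:
  assumes "finite A" "partial_order_on A r" "\<C> \<subseteq> \<F>" "card A \<le> card \<C>"
    and "\<And>X Y. X \<in> \<C> \<Longrightarrow> Y \<in> \<C> \<Longrightarrow> X \<subseteq> Y \<or> Y \<subseteq> X"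
  shows "\<not> poset_free A r \<F>"
proof -
  obtain \<C>' where \<C>': "\<C>' \<subseteq> \<C>" "card \<C>' = card A" "finite \<C>'"
    using obtain_subset_with_card_n[OF assms(4)] by metis
  have "noninduced_copy A r \<C>'"
    by (rule chain_noninduced_copy)
      (use assms \<C>' in \<open>auto simp: partial_order_on_def preorder_on_def\<close>)
  then show ?thesis
    using \<C>'(1) assms(3) unfolding poset_free_def by blast
qed

section \<open>The colex order\<close>

text \<open>For \<open>Y \<subseteq> X\<close> the symmetric difference is \<open>X - Y\<close>,
  whose maximum is not in \<open>Y\<close>. This later tells an earlier \<open>colex_F\<close> from
  the complement of one.\<close>

lemma colex_less_not_supset:
  assumes "colex_less X Y" "finite X"
  shows "\<not> Y \<subseteq> X"
proof
  assume "Y \<subseteq> X"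
  then have "X - Y \<noteq> {}" "(X - Y) \<union> (Y - X) = X - Y"
    using assms(1) by (auto simp: colex_less_def)
  then show False
    using Max_in[of "X - Y"] assms by (auto simp: colex_less_def)
qed

text \<open>An element of \<open>X\<close> above \<open>j\<close> would lie in the symmetric
  difference and push its maximum beyond \<open>Y\<close>.\<close>

lemma colex_less_atMost:
  assumes "colex_less X Y" "finite X" "Y \<subseteq> {..j}"
  shows "X \<subseteq> {..j}"
proof (rule ccontr)
  assume "\<not> X \<subseteq> {..j}"
  then obtain x where x: "x \<in> X" "j < x" by force
  have "finite ((X - Y) \<union> (Y - X))"
    using assms(2,3) finite_subset by auto
  then have "x \<le> Max ((X - Y) \<union> (Y - X))"
    by (rule Max_ge) (use x assms(3) in auto)
  then show False using assms x(2) by (auto simp: colex_less_def)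
qed

text \<open>Sets containing \<open>Suc m\<close> come after all others and keep their relative
  order. A sorted enumeration is unique, so it suffices that the right side is one.\<close>

lemma colex_list_Suc: "colex_list (Suc m) = colex_list m @ map (insert (Suc m)) (colex_list m)"
  (is "_ = ?Gs")
proof (rule sorted_wrt_asym_unique[of "Pow {1..Suc m}" colex_less])
  have "sorted_wrt (\<lambda>X Y. colex_less (insert (Suc m) X) (insert (Suc m) Y)) (colex_list m)"
    by (rule sorted_wrt_mono_rel[OF _ sorted_colex_list])
      (use set_colex_list colex_less_insert in auto)
  then show "sorted_wrt colex_less ?Gs"
    using colex_less_new sorted_colex_list set_colex_list
    by (auto simp: sorted_wrt_append sorted_wrt_map)
  show "set (colex_list (Suc m)) = set ?Gs"
    by (simp add: set_colex_list atLeastAtMostSuc_conv Pow_insert)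
  show "\<not> colex_less Y X" if "X \<in> Pow {1..Suc m}" "Y \<in> Pow {1..Suc m}" "colex_less X Y" for X Y
    by (rule colex_less_asym) (use that finite_subset[of _ "{1..Suc m}"] in simp_all)
qed (simp_all add: set_colex_list sorted_colex_list)

lemma length_colex_list: "length (colex_list m) = 2 ^ m"
proof (induction m)
  case 0
  have "sorted_wrt colex_less [{}]" "set (colex_list 0) = {{}}"
    by (simp_all add: set_colex_list)
  then have "colex_list 0 = [{}]"
    by (intro sorted_wrt_asym_unique[of "{{}}" colex_less])
      (auto simp: sorted_colex_list colex_less_def)
  then show ?case by simp
qed (simp add: colex_list_Suc)

text \<open>Each smaller power set is an initial block, so for \<open>m \<le> n - 1\<close> the
  first \<open>2 ^ m\<close> steps treat exactly the subsets of \<open>[m]\<close> and their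
  complements.\<close>

lemma take_colex_list: "m \<le> N \<Longrightarrow> take (2 ^ m) (colex_list N) = colex_list m"
proof (induction N rule: dec_induct)
  case base
  then show ?case by (simp add: length_colex_list)
next
  case (step N)
  then show ?case by (simp add: colex_list_Suc length_colex_list)
qed

lemma colex_F_image:
  assumes "m \<le> n - 1"
  shows "(\<lambda>i. colex_F n (Suc i)) ` {..<2 ^ m} = Pow {1..m}"
proof -
  have "(2::nat) ^ m \<le> 2 ^ (n - 1)" using assms by simp
  then have "(\<lambda>i. colex_F n (Suc i)) ` {..<2 ^ m} = set (take (2 ^ m) (colex_list (n - 1)))"
    by (auto simp: nth_image[symmetric] length_colex_list colex_F_def lessThan_atLeast0)
  also have "\<dots> = Pow {1..m}" by (simp only: take_colex_list[OF assms] set_colex_list)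
  finally show ?thesis .
qed

lemma colex_F_subset: "i < 2 ^ (n - 1) \<Longrightarrow> colex_F n (Suc i) \<subseteq> {1..n - 1}"
  using nth_mem[of i "colex_list (n - 1)"]
  by (simp add: length_colex_list set_colex_list colex_F_def)

lemma colex_F_less:
  "l < i \<Longrightarrow> i < 2 ^ (n - 1) \<Longrightarrow> colex_less (colex_F n (Suc l)) (colex_F n (Suc i))"
  unfolding colex_F_def
  by (simp add: sorted_wrt_nth_less[OF sorted_colex_list] length_colex_list)

section \<open>The greedy process\<close>

lemma add_if_free_supset: "\<F> \<subseteq> add_if_free A r X \<F>"
  by (auto simp: add_if_free_def)

lemma greedy_colex_mono: "i \<le> j \<Longrightarrow> greedy_colex n A r i \<subseteq> greedy_colex n A r j"
proof (induction j rule: dec_induct)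
  case (step j)
  have "greedy_colex n A r j \<subseteq> greedy_colex n A r (Suc j)"
    unfolding greedy_colex.simps by (rule order_trans[OF add_if_free_supset add_if_free_supset])
  with step.IH show ?case by (rule order_trans)
qed simp

lemma greedy_colex_free:
  assumes "A \<noteq> {}"
  shows "poset_free A r (greedy_colex n A r i)"
  by (induction i) (auto simp: poset_free_empty assms add_if_free_def)

lemma greedy_colex_subset:
  "greedy_colex n A r i \<subseteq> (\<lambda>l. colex_F n (Suc l)) ` {..<i} \<union> (\<lambda>l. colex_G n (Suc l)) ` {..<i}"
  by (induction i) (auto simp: add_if_free_def lessThan_Suc split: if_splits)

lemma greedy_colex_Pow:
  assumes "i \<le> 2 ^ (n - 1)"
  shows "greedy_colex n A r i \<subseteq> Pow {1..n}"
proof -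
  have "colex_F n (Suc l) \<subseteq> {1..n}" if "l < i" for l
    using colex_F_subset[of l n] that assms by fastforce
  then show ?thesis
    using greedy_colex_subset[of n A r i] unfolding colex_G_def by fast
qed

lemma card_greedy_colex: "card (greedy_colex n A r i) \<le> 2 * i"
proof -
  have "card (greedy_colex n A r i)
      \<le> card ((\<lambda>l. colex_F n (Suc l)) ` {..<i} \<union> (\<lambda>l. colex_G n (Suc l)) ` {..<i})"
    by (rule card_mono[OF _ greedy_colex_subset]) auto
  also have "\<dots> \<le> card {..<i} + card {..<i}"
    by (rule order_trans[OF card_Un_le add_mono]) (rule card_image_le, simp)+
  finally show ?thesis by simp
qed

text \<open>Members are never removed, so a set missing later failed its own test.\<close>

lemma greedy_colex_rejected_F:
  assumes "colex_F n (Suc i) \<notin> greedy_colex n A r N" "i < N"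
  shows "\<not> poset_free A r (insert (colex_F n (Suc i)) (greedy_colex n A r i))"
proof
  assume "poset_free A r (insert (colex_F n (Suc i)) (greedy_colex n A r i))"
  then have "colex_F n (Suc i) \<in> greedy_colex n A r (Suc i)"
    using add_if_free_supset[of _ A r "colex_G n (Suc i)"] by (auto simp: add_if_free_def)
  then show False using assms greedy_colex_mono[of "Suc i" N n A r] by auto
qed

text \<open>The test of \<open>colex_G\<close> follows that of \<open>colex_F\<close> in the same
  step, hence it runs against the intermediate family.\<close>

lemma greedy_colex_rejected_G:
  assumes "colex_G n (Suc i) \<notin> greedy_colex n A r N" "i < N"
  shows "\<not> poset_free A r (insert (colex_G n (Suc i))
           (add_if_free A r (colex_F n (Suc i)) (greedy_colex n A r i)))"
proof
  assume "poset_free A r (insert (colex_G n (Suc i))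
           (add_if_free A r (colex_F n (Suc i)) (greedy_colex n A r i)))"
  then have "colex_G n (Suc i) \<in> greedy_colex n A r (Suc i)"
    by (simp add: add_if_free_def)
  then show False using assms greedy_colex_mono[of "Suc i" N n A r] by auto
qed

lemma greedy_colex_partial_subset:
  assumes "i < N"
  shows "add_if_free A r (colex_F n (Suc i)) (greedy_colex n A r i) \<subseteq> greedy_colex n A r N"
proof -
  have "add_if_free A r (colex_F n (Suc i)) (greedy_colex n A r i) \<subseteq> greedy_colex n A r (Suc i)"
    using add_if_free_supset by simp
  then show ?thesis using greedy_colex_mono[of "Suc i" N n A r] assms by simp
qed

section \<open>Segments forced into the family by an addable set\<close>

lemma initial_segment_accepted:
  assumes "m \<le> n - 1" "j \<le> m" "X \<subseteq> {1..n}" "X \<notin> greedy_colex n A r (2 ^ m)"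
    and free: "poset_free A r (insert X (greedy_colex n A r (2 ^ m)))"
  shows "X \<inter> {1..j} \<in> greedy_colex n A r (2 ^ m)"
proof (rule ccontr)
  assume rej: "X \<inter> {1..j} \<notin> greedy_colex n A r (2 ^ m)"
  have "X \<inter> {1..j} \<in> Pow {1..m}" using assms(2) by auto
  then obtain i where i: "i < 2 ^ m" "colex_F n (Suc i) = X \<inter> {1..j}"
    unfolding colex_F_image[OF assms(1), symmetric] by auto
  have i': "i < 2 ^ (n - 1)"
    using i(1) power_increasing[OF assms(1), of "2::nat"] by linarith
  have sub: "greedy_colex n A r i \<subseteq> greedy_colex n A r (2 ^ m)"
    using i(1) by (simp add: greedy_colex_mono)
  \<comment> \<open>The copy behind the rejection moves from \<open>X \<inter> {1..j}\<close> to
    \<open>X\<close>. Sets below the former are below \<open>X\<close> trivially, so only sets above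
    it need an argument.\<close>
  have "\<not> poset_free A r (insert X (greedy_colex n A r i))"
  proof (rule not_poset_free_replace)
    show "\<not> poset_free A r (insert (X \<inter> {1..j}) (greedy_colex n A r i))"
      using greedy_colex_rejected_F[of n i A r "2 ^ m"] i rej by simp
    show "X \<notin> greedy_colex n A r i" using sub assms(4) by blast
  next
    fix Z assume "Z \<in> greedy_colex n A r i" "X \<inter> {1..j} \<subseteq> Z"
    then obtain l where l: "l < i" "Z = colex_F n (Suc l) \<or> Z = colex_G n (Suc l)"
      using greedy_colex_subset[of n A r i] by auto
    let ?B = "colex_F n (Suc l)"
    have less: "colex_less ?B (X \<inter> {1..j})"
      using colex_F_less[OF l(1) i'] i(2) by simp
    have B: "?B \<subseteq> {1..n - 1}" using colex_F_subset[of l n] l(1) i' by simp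
    then have fin: "finite ?B" using finite_subset by blast
    have "?B \<subseteq> {..j}" by (rule colex_less_atMost[OF less fin]) auto
    then have "?B \<subseteq> {1..j}" using B by fastforce
    \<comment> \<open>The earlier \<open>?B\<close> cannot contain \<open>X \<inter> {1..j}\<close>,
      so \<open>Z\<close> is its complement. As \<open>?B \<subseteq> {1..j}\<close>, this
      \<open>Z\<close> contains all of \<open>[n]\<close> beyond \<open>j\<close>.\<close>
    moreover have "Z = {1..n} - ?B"
      using colex_less_not_supset[OF less fin] \<open>X \<inter> {1..j} \<subseteq> Z\<close> l(2) by (auto simp: colex_G_def)
    ultimately show "X \<subseteq> Z" using \<open>X \<inter> {1..j} \<subseteq> Z\<close> assms(3) by blast
  qed auto
  then show False using free sub poset_free_subset by (metis insert_mono)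
qed

lemma final_segment_accepted:
  assumes "m \<le> n - 1" "j \<le> m" "X \<subseteq> {1..n}" "X \<notin> greedy_colex n A r (2 ^ m)"
    and free: "poset_free A r (insert X (greedy_colex n A r (2 ^ m)))"
  shows "{1..n} - ({1..j} - X) \<in> greedy_colex n A r (2 ^ m)"
proof (rule ccontr)
  let ?Y = "{1..n} - ({1..j} - X)"
  assume rej: "?Y \<notin> greedy_colex n A r (2 ^ m)"
  have "{1..j} - X \<in> Pow {1..m}" using assms(2) by auto
  then obtain i where i: "i < 2 ^ m" "colex_F n (Suc i) = {1..j} - X"
    unfolding colex_F_image[OF assms(1), symmetric] by auto
  then have Gi: "colex_G n (Suc i) = ?Y" by (simp add: colex_G_def)
  have i': "i < 2 ^ (n - 1)"
    using i(1) power_increasing[OF assms(1), of "2::nat"] by linarith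
  \<comment> \<open>This intermediate family may already contain the partner
    \<open>{1..j} - X\<close>, which gets its own case below.\<close>
  let ?H = "add_if_free A r (colex_F n (Suc i)) (greedy_colex n A r i)"
  have sub: "?H \<subseteq> greedy_colex n A r (2 ^ m)"
    by (rule greedy_colex_partial_subset[OF i(1)])
  have "\<not> poset_free A r (insert X ?H)"
  proof (rule not_poset_free_replace)
    show "\<not> poset_free A r (insert ?Y ?H)"
      using greedy_colex_rejected_G[of n i A r "2 ^ m"] i(1) rej unfolding Gi by simp
    show "X \<notin> ?H" using sub assms(4) by blast
  next
    fix Z assume Z: "Z \<in> ?H" "Z \<subseteq> ?Y"
    show "Z \<subseteq> X"
    proof (cases "Z = {1..j} - X")
      case True
      \<comment> \<open>Here \<open>{1..j} - X\<close> lies inside its own complement, so it is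
        empty.\<close>
      then show ?thesis using Z(2) assms(1,2) by auto
    next
      case False
      then have "Z \<in> greedy_colex n A r i"
        using Z(1) i(2) by (auto simp: add_if_free_def split: if_splits)
      then obtain l where l: "l < i" "Z = colex_F n (Suc l) \<or> Z = colex_G n (Suc l)"
        using greedy_colex_subset[of n A r i] by auto
      let ?B = "colex_F n (Suc l)"
      have less: "colex_less ?B ({1..j} - X)"
        using colex_F_less[OF l(1) i'] i(2) by simp
      have B: "?B \<subseteq> {1..n - 1}" using colex_F_subset[of l n] l(1) i' by simp
      then have fin: "finite ?B" using finite_subset by blast
      have "?B \<subseteq> {..j}" by (rule colex_less_atMost[OF less fin]) auto
      then have "?B \<subseteq> {1..j}" using B by fastforce
      moreover have "{1..j} - X \<subseteq> {1..n}" using assms(1,2) by auto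
      \<comment> \<open>A complement \<open>{1..n} - ?B\<close> inside \<open>?Y\<close> would give
        \<open>{1..j} - X \<subseteq> ?B\<close>, against the colex order.\<close>
      then have "Z = ?B"
        using colex_less_not_supset[OF less fin] Z(2) l(2) by (auto simp: colex_G_def)
      ultimately show ?thesis using Z(2) by blast
    qed
  qed (use assms(3) in auto)
  then show False using free sub poset_free_subset by (metis insert_mono)
qed

section \<open>The chain through a set outside the family; saturation and stability\<close>

lemma card_initial_segments:
  "card ((\<lambda>j. S \<inter> {1..j}) ` {..m}) = Suc (card (S \<inter> {1..m::nat}))"
proof (induction m)
  case (Suc m)
  have im: "(\<lambda>j. S \<inter> {1..j}) ` {..Suc m}
      = insert (S \<inter> {1..Suc m}) ((\<lambda>j. S \<inter> {1..j}) ` {..m})"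
    by (simp add: atMost_Suc)
  \<comment> \<open>A new set appears exactly when \<open>Suc m \<in> S\<close>; the
    \<open>Suc\<close> in the formula counts the empty set at \<open>j = 0\<close>.\<close>
  show ?case
  proof (cases "Suc m \<in> S")
    case True
    then have "S \<inter> {1..Suc m} = insert (Suc m) (S \<inter> {1..m})" by auto
    moreover have "S \<inter> {1..Suc m} \<notin> (\<lambda>j. S \<inter> {1..j}) ` {..m}"
    proof
      assume "S \<inter> {1..Suc m} \<in> (\<lambda>j. S \<inter> {1..j}) ` {..m}"
      then obtain j where "j \<le> m" and eq: "S \<inter> {1..Suc m} = S \<inter> {1..j}"
        by (elim imageE) simp
      have "Suc m \<in> S \<inter> {1..Suc m}" using True by simp
      then have "Suc m \<in> S \<inter> {1..j}" unfolding eq .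
      then show False using \<open>j \<le> m\<close> by simp
    qed
    ultimately show ?thesis using Suc im by simp
  next
    case False
    then have "S \<inter> {1..Suc m} = S \<inter> {1..m}" by (auto simp: le_Suc_eq)
    then show ?thesis using Suc im by (simp add: insert_absorb)
  qed
qed simp

text \<open>The bound on \<open>card A\<close> is an inequality so that \<open>m = 0\<close> also
  serves posets with one or two elements.\<close>

lemma greedy_colex_saturating:
  assumes "partial_order_on A r" "finite A" "A \<noteq> {}" "card A \<le> m + 3" "m \<le> n - 1"
  shows "noninduced_saturating n A r (greedy_colex n A r (2 ^ m))"
proof -
  let ?F = "greedy_colex n A r (2 ^ m)"
  \<comment> \<open>This includes sets already considered and rejected; the argument is the same for
    them.\<close>
  have "\<not> poset_free A r (insert X ?F)" if X: "X \<in> Pow {1..n} - ?F" for X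
  proof
    assume free: "poset_free A r (insert X ?F)"
    \<comment> \<open>\<open>L\<close> and \<open>U'\<close> consist of initial segments of
      \<open>X\<close> and of \<open>- X\<close>, so one counting lemma serves both;
      \<open>U\<close> holds the complements in \<open>[n]\<close> of the members of
      \<open>U'\<close>.\<close>
    define L where "L = (\<lambda>j. X \<inter> {1..j}) ` {..m}"
    define U' where "U' = (\<lambda>j. - X \<inter> {1..j}) ` {..m}"
    define U where "U = (\<lambda>Z. {1..n} - Z) ` U'"
    have L: "L \<subseteq> ?F"
      using initial_segment_accepted[OF assms(5) _ _ _ free] X unfolding L_def by auto
    have U: "U \<subseteq> ?F"
      using final_segment_accepted[OF assms(5) _ _ _ free] X
      unfolding U_def U'_def by (auto simp: Diff_eq Int_commute)
    have U'n: "U' \<subseteq> Pow {1..n}" using assms(5) unfolding U'_def by auto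
    have fin: "finite L" "finite U" by (simp_all add: L_def U_def U'_def)
    \<comment> \<open>Strict, because \<open>L\<close> lies in the family and \<open>X\<close> does
      not.\<close>
    have Lsub: "Z \<subset> X" if "Z \<in> L" for Z using that L X unfolding L_def by auto
    have Usup: "X \<subset> Z" if "Z \<in> U" for Z
    proof -
      have "X \<subseteq> Z" using that X unfolding U_def U'_def by auto
      then show ?thesis using that U X by blast
    qed
    have "card U = card U'"
      unfolding U_def by (rule card_image) (use U'n in \<open>auto intro!: inj_onI\<close>)
    moreover have "card (L \<union> U) = card L + card U"
      by (rule card_Un_disjoint[OF fin]) (use Lsub Usup in blast)
    moreover have "card (insert X (L \<union> U)) = Suc (card (L \<union> U))"
      using fin Lsub Usup by (intro card_insert_disjoint) blast+
    moreover have "card (X \<inter> {1..m}) + card (- X \<inter> {1..m}) = m"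
    proof -
      have "card (X \<inter> {1..m}) + card (- X \<inter> {1..m}) = card ((X \<inter> {1..m}) \<union> (- X \<inter> {1..m}))"
        by (rule card_Un_disjoint[symmetric]) auto
      also have "(X \<inter> {1..m}) \<union> (- X \<inter> {1..m}) = {1..m}" by auto
      finally show ?thesis by simp
    qed
    \<comment> \<open>The summands are \<open>card (X \<inter> {1..m}) + 1\<close>,
      \<open>card (- X \<inter> {1..m}) + 1\<close> and one for \<open>X\<close> itself.\<close>
    ultimately have card: "card (insert X (L \<union> U)) = m + 3"
      using card_initial_segments[of X m] card_initial_segments[of "- X" m]
      by (simp add: L_def U'_def)
    have seg: "S \<inter> {1..i} \<subseteq> S \<inter> {1..j} \<or> S \<inter> {1..j} \<subseteq> S \<inter> {1..i}" for S and i j :: nat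
      using linear[of i j] by auto
    have chainL: "Y \<subseteq> Z \<or> Z \<subseteq> Y" if "Y \<in> L" "Z \<in> L" for Y Z
      using that unfolding L_def by (elim imageE) (simp only: seg)
    have chainU': "Y \<subseteq> Z \<or> Z \<subseteq> Y" if "Y \<in> U'" "Z \<in> U'" for Y Z
      using that unfolding U'_def by (elim imageE) (simp only: seg)
    have chainU: "Y \<subseteq> Z \<or> Z \<subseteq> Y" if "Y \<in> U" "Z \<in> U" for Y Z
    proof -
      obtain Y' where Y': "Y = {1..n} - Y'" "Y' \<in> U'"
        using \<open>Y \<in> U\<close> unfolding U_def by (rule imageE)
      obtain Z' where Z': "Z = {1..n} - Z'" "Z' \<in> U'"
        using \<open>Z \<in> U\<close> unfolding U_def by (rule imageE)
      show ?thesis using chainU'[OF Y'(2) Z'(2)] unfolding Y'(1) Z'(1) by blast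
    qed
    have "\<not> poset_free A r (insert X ?F)"
    proof (rule not_poset_free_chain[OF assms(2,1)])
      show "insert X (L \<union> U) \<subseteq> insert X ?F" using L U by blast
      show "card A \<le> card (insert X (L \<union> U))" using card assms(4) by simp
      fix Y Z assume "Y \<in> insert X (L \<union> U)" "Z \<in> insert X (L \<union> U)"
      then have "Y \<in> L \<or> Y = X \<or> Y \<in> U" "Z \<in> L \<or> Z = X \<or> Z \<in> U" by auto
      then show "Y \<subseteq> Z \<or> Z \<subseteq> Y"
        using chainL chainU Lsub Usup by (metis order_trans psubset_imp_subset order_refl)
    qed
    then show False using free by contradiction
  qed
  moreover have "?F \<subseteq> Pow {1..n}"
    by (rule greedy_colex_Pow) (use assms(5) in simp)
  ultimately show ?thesis
    using greedy_colex_free[OF assms(3)] unfolding noninduced_saturating_def by metis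
qed

text \<open>By saturation every later test of a new set fails, and accepting an old set changes
  nothing.\<close>

lemma greedy_colex_stable:
  assumes "noninduced_saturating n A r (greedy_colex n A r i)" "i \<le> j" "j \<le> 2 ^ (n - 1)"
  shows "greedy_colex n A r j = greedy_colex n A r i"
  using assms(2,3)
proof (induction j rule: dec_induct)
  case (step j)
  let ?F = "greedy_colex n A r i"
  have *: "add_if_free A r X ?F = ?F" if "X \<subseteq> {1..n}" for X
    using assms(1) that unfolding noninduced_saturating_def add_if_free_def by auto
  have "colex_F n (Suc j) \<subseteq> {1..n}"
    using colex_F_subset[of j n] step.prems by fastforce
  moreover have "colex_G n (Suc j) \<subseteq> {1..n}" by (auto simp: colex_G_def)
  ultimately show ?case using step * by simp
qed simp

section \<open>The bound on \<open>sat\<close> and the final assembly\<close>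

lemma sat_le:
  assumes "noninduced_saturating n A r \<F>"
  shows "sat n A r \<le> card \<F>"
proof -
  have "finite {\<F>. noninduced_saturating n A r \<F>}"
    by (rule finite_subset[of _ "Pow (Pow {1..n})"]) (auto simp: noninduced_saturating_def)
  then show ?thesis unfolding sat_def using assms by (intro Min_le) auto
qed

text \<open>Integer exponents allow for \<open>k - 3\<close> or \<open>k - 2\<close> being negative:
  for \<open>k = 1\<close> and \<open>k = 2\<close> the step numbers \<open>1/4\<close> and
  \<open>1/2\<close> round up to one, and for \<open>k = 1\<close> the size bound \<open>1/2\<close>
  forces the empty family.\<close>

theorem theorem7:
  fixes A :: "'a set" and r :: "'a rel" and n k :: nat
  assumes "1 \<le> k" and "k \<le> n"
    and "partial_order_on A r" and "finite A" and "card A = k"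
  shows "noninduced_saturating n A r (greedy_output n A r) \<and>
         greedy_output n A r = greedy_colex n A r (nat \<lceil>(2::real) powi (int k - 3)\<rceil>) \<and>
         real (card (greedy_output n A r)) \<le> 2 powi (int k - 2) \<and>
         real (sat n A r) \<le> 2 powi (int k - 2)"
proof -
  \<comment> \<open>Subtraction on \<open>nat\<close> gives \<open>m = 0\<close> for
    \<open>k \<le> 2\<close>, and \<open>2 ^ 0 = 1\<close> agrees with the rounded step
    number.\<close>
  define m where "m = k - 3"
  let ?F = "greedy_colex n A r (2 ^ m)"
  have ne: "A \<noteq> {}" using assms(1,5) by auto
  have mn: "m \<le> n - 1" using assms(1,2) by (simp add: m_def)
  have sat: "noninduced_saturating n A r ?F"
    by (rule greedy_colex_saturating[OF assms(3,4) ne _ mn]) (simp add: m_def assms(5))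
  have out: "greedy_output n A r = ?F"
    unfolding greedy_output_def
    by (rule greedy_colex_stable[OF sat]) (use mn in simp_all)
  have small: "k = 1 \<or> k = 2 \<or> (k = m + 3)" using assms(1) by (auto simp: m_def)
  have quarter: "\<lceil>1 / 4 :: real\<rceil> = 1" and half: "\<lceil>1 / 2 :: real\<rceil> = 1"
    by (rule ceiling_unique; simp)+
  have steps: "nat \<lceil>(2::real) powi (int k - 3)\<rceil> = 2 ^ m"
  proof -
    consider "k = 1" | "k = 2" | "k = m + 3" using small by blast
    then show ?thesis
    proof cases
      case 3
      have "\<lceil>(2::real) powi (int k - 3)\<rceil> = \<lceil>real_of_int (2 ^ m)\<rceil>"
        by (subst 3) simp
      also have "\<dots> = 2 ^ m" by (rule ceiling_of_int)
      finally show ?thesis by (simp add: nat_power_eq)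
    qed (simp_all add: m_def power_int_def power2_eq_square quarter half)
  qed
  have card: "real (card ?F) \<le> 2 powi (int k - 2)"
  proof (cases "k = m + 3")
    case True
    have "real (card ?F) \<le> real (2 * 2 ^ m)"
      using card_greedy_colex[of n A r "2 ^ m"] by linarith
    also have "\<dots> = 2 ^ (m + 1)" by simp
    also have "\<dots> = 2 powi (int k - 2)"
    proof -
      have "int k - 2 = int (m + 1)" using True by simp
      then show ?thesis by (metis power_int_of_nat)
    qed
    finally show ?thesis .
  next
    case False
    \<comment> \<open>For \<open>k \<le> 2\<close> the count \<open>2 * 2 ^ m = 2\<close> is too
      weak. After one step the family lies in the chain \<open>{{}, {1..n}}\<close>, so freeness
      leaves fewer than \<open>k\<close> sets.\<close>
    then have m0: "m = 0" by (auto simp: m_def)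
    have "?F \<subseteq> {colex_F n 1, colex_G n 1}"
      using greedy_colex_subset[of n A r 1] m0 by auto
    moreover have "colex_F n 1 = {}"
      using colex_F_image[of 0 n] by (simp add: lessThan_Suc)
    ultimately have "?F \<subseteq> {{}, {1..n}}" by (simp add: colex_G_def)
    then have "\<not> card A \<le> card ?F"
      using not_poset_free_chain[OF assms(4,3) order_refl, of ?F] greedy_colex_free[OF ne, of r n "2 ^ m"]
      by blast
    then show ?thesis using small False assms(5) by (auto simp: power_int_def)
  qed
  have "real (sat n A r) \<le> 2 powi (int k - 2)"
    using sat_le[OF sat] card by linarith
  then show ?thesis unfolding out steps using sat card by blast
qed

end
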